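(* Let $n\ge 2$ and let $\Sigma^n\subset\{x_{n+1}>0\}\subset\mathbb R^{n+1}$ be an immersed minimal hypersurface. Write $x=(z,x_n,x_{n+1})$ with $z=(x_1,\dots,x_{n-1})$, fix $s>0$, let $p'=(0,\dots,0,s,s)$, and define $f(x)=|x-p'|^2-\frac{n}{n-1}|z|^2$. Then $\Delta_\Sigma f\ge 0$ on $\Sigma$. If moreover $B_s\cap\Sigma\subset\{x_n>0\}$, where $B_s$ is the open ball of radius $s$ centered at the origin, then every point $x$ in the closure of $B_s\cap\Sigma$ with $|x|=s$ satisfies $$f(x)\le\Big(2-\frac{1}{n-1}\Big)s^2 .$$
   Context: $\Delta_\Sigma$ is the Laplace–Beltrami operator of $\Sigma$. *)

theory Defs
  imports "HOL-Analysis.Analysis"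
begin

definition pd :: "'k::finite \<Rightarrow> (real^'k \<Rightarrow> 'b::real_normed_vector) \<Rightarrow> real^'k \<Rightarrow> 'b" where
  "pd i h u = frechet_derivative h (at u) (axis i 1)"

fun pds :: "'k::finite list \<Rightarrow> (real^'k \<Rightarrow> 'b::real_normed_vector) \<Rightarrow> real^'k \<Rightarrow> 'b" where
  "pds [] h = h"
| "pds (i # is) h = pd i (pds is h)"

definition smooth_on :: "(real^'k::finite) set \<Rightarrow> (real^'k \<Rightarrow> 'b::real_normed_vector) \<Rightarrow> bool" where
  "smooth_on U h \<longleftrightarrow> (\<forall>is. pds is h differentiable_on U)"

definition metric :: "(real^'k::finite \<Rightarrow> real^'m::finite) \<Rightarrow> real^'k \<Rightarrow> real^'k^'k" where
  "metric \<phi> u = (\<chi> i j. pd i \<phi> u \<bullet> pd j \<phi> u)"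

definition inv_metric :: "(real^'k::finite \<Rightarrow> real^'m::finite) \<Rightarrow> real^'k \<Rightarrow> real^'k^'k" where
  "inv_metric \<phi> u = matrix_inv (metric \<phi> u)"

text \<open>A (local parametrization of an) immersed hypersurface piece: smooth map from open U with
  injective differential everywhere.\<close>
definition immersion_on :: "(real^'k::finite) set \<Rightarrow> (real^'k \<Rightarrow> real^'m::finite) \<Rightarrow> bool" where
  "immersion_on U \<phi> \<longleftrightarrow> open U \<and> smooth_on U \<phi> \<and> (\<forall>u\<in>U. inj (frechet_derivative \<phi> (at u)))"

definition tangent_proj :: "(real^'k::finite \<Rightarrow> real^'m::finite) \<Rightarrow> real^'k \<Rightarrow> real^'m \<Rightarrow> real^'m" where
  "tangent_proj \<phi> u v =
     (\<Sum>k\<in>UNIV. \<Sum>l\<in>UNIV. (inv_metric \<phi> u $ k $ l * (v \<bullet> pd k \<phi> u)) *\<^sub>R pd l \<phi> u)"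

definition mean_curvature_vec :: "(real^'k::finite \<Rightarrow> real^'m::finite) \<Rightarrow> real^'k \<Rightarrow> real^'m" where
  "mean_curvature_vec \<phi> u =
     (\<Sum>i\<in>UNIV. \<Sum>j\<in>UNIV. inv_metric \<phi> u $ i $ j *\<^sub>R
        (pd i (pd j \<phi>) u - tangent_proj \<phi> u (pd i (pd j \<phi>) u)))"

definition minimal_immersion_on :: "(real^'k::finite) set \<Rightarrow> (real^'k \<Rightarrow> real^'m::finite) \<Rightarrow> bool" where
  "minimal_immersion_on U \<phi> \<longleftrightarrow> immersion_on U \<phi> \<and> (\<forall>u\<in>U. mean_curvature_vec \<phi> u = 0)"

definition laplace_beltrami :: "(real^'k::finite \<Rightarrow> real^'m::finite) \<Rightarrow> (real^'k \<Rightarrow> real) \<Rightarrow> real^'k \<Rightarrow> real" where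
  "laplace_beltrami \<phi> h u =
     (1 / sqrt (det (metric \<phi> u))) *
     (\<Sum>i\<in>UNIV. pd i (\<lambda>v. sqrt (det (metric \<phi> v)) *
                          (\<Sum>j\<in>UNIV. inv_metric \<phi> v $ i $ j * pd j h v)) u)"

text \<open>The test function f(x) = |x - p'|^2 - n/(n-1) |z|^2, where coordinate a plays the role of
  x_n, coordinate b that of x_{n+1}, z collects the remaining n-1 coordinates, p' = s e_a + s e_b.\<close>
definition pprime :: "'m::finite \<Rightarrow> 'm \<Rightarrow> real \<Rightarrow> real^'m" where
  "pprime a b s = (\<chi> k. if k = a \<or> k = b then s else 0)"

definition ftest :: "nat \<Rightarrow> 'm::finite \<Rightarrow> 'm \<Rightarrow> real \<Rightarrow> real^'m \<Rightarrow> real" where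
  "ftest n a b s x = (norm (x - pprime a b s))\<^sup>2
      - real n / (real n - 1) * (\<Sum>k\<in>UNIV - {a, b}. (x $ k)\<^sup>2)"

end

(*
  For an immersion \<phi> and a function h on R^(n+1) with gradient W, the coordinate formula
  \<Delta>\<^sub>\<Sigma> u = g^ij (d_i d_j u - \<Gamma>^l_ij d_l u) gives
  \<Delta>\<^sub>\<Sigma> (h o \<phi>) = g^ij <DW(d_i \<phi>), d_j \<phi>> + <W, H>,
  because the Christoffel terms remove exactly the tangential part of d_i d_j \<phi>.
  The Hessian of f is 2 I - 2n/(n-1) \<pi>_z, with \<pi>_z the projection onto the z-coordinates.
  The tangential trace of I is n, and that of \<pi>_z is the sum of |(e_k)^T|^2 <= 1 over the
  n-1 coordinate vectors e_k of z, so on a minimal hypersurface \<Delta>\<^sub>\<Sigma> f >= 2n - 2n = 0.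

  On the closure of B_s \<inter> \<Sigma> both x_n and x_(n+1) are nonnegative, and for |x| = s
  f(x) = (2 - 1/(n-1)) s^2 - x_n (2s - n/(n-1) x_n) - x_(n+1) (2s - n/(n-1) x_(n+1)),
  where both subtracted terms are nonnegative because 0 <= x_k <= s and n/(n-1) <= 2.
*)

theory Submission
  imports Defs
begin

section \<open>Partial derivatives\<close>

lemma pd_eq_has_derivative: "(f has_derivative f') (at u) \<Longrightarrow> pd i f u = f' (axis i 1)"
  unfolding pd_def by (metis frechet_derivative_at)

lemma frechet_derivative_eq_sum_pd:
  fixes f :: "real^'k::finite \<Rightarrow> 'b::real_normed_vector"
  assumes "f differentiable at u"
  shows "frechet_derivative f (at u) d = (\<Sum>j\<in>UNIV. d $ j *\<^sub>R pd j f u)"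
proof -
  have "linear (frechet_derivative f (at u))"
    using assms linear_frechet_derivative by blast
  have "d = (\<Sum>j\<in>UNIV. d $ j *\<^sub>R axis j 1)"
    by (metis (no_types, lifting) basis_expansion scalar_mult_eq_scaleR sum.cong vector_smult_rzero)
  then have "frechet_derivative f (at u) d = frechet_derivative f (at u) (\<Sum>j\<in>UNIV. d $ j *\<^sub>R axis j 1)"
    by simp
  also have "\<dots> = (\<Sum>j\<in>UNIV. d $ j *\<^sub>R pd j f u)"
    using \<open>linear (frechet_derivative f (at u))\<close> by (simp add: linear_sum linear_scale pd_def)
  finally show ?thesis .
qed

lemma has_real_derivative_inner_along_line:
  fixes f :: "'a::real_normed_vector \<Rightarrow> 'b::real_inner"
  assumes "f differentiable at (y + t *\<^sub>R e)"
  shows "((\<lambda>t. w \<bullet> f (y + t *\<^sub>R e)) has_real_derivative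
           w \<bullet> frechet_derivative f (at (y + t *\<^sub>R e)) e) (at t)"
proof -
  let ?D = "frechet_derivative f (at (y + t *\<^sub>R e))"
  have "((\<lambda>t. y + t *\<^sub>R e) has_derivative (\<lambda>t. t *\<^sub>R e)) (at t)"
    by (auto intro!: derivative_eq_intros)
  from diff_chain_at[OF this assms[unfolded frechet_derivative_works]]
  have "((\<lambda>t. w \<bullet> f (y + t *\<^sub>R e)) has_derivative (\<lambda>t. w \<bullet> ?D (t *\<^sub>R e))) (at t)"
    by (auto simp: o_def intro: has_derivative_inner_right)
  moreover have "(\<lambda>t. w \<bullet> ?D (t *\<^sub>R e)) = (\<lambda>t. (w \<bullet> ?D e) * t)"
    using assms linear_frechet_derivative by (fastforce simp: linear_scale)
  ultimately show ?thesis
    unfolding has_field_derivative_def by simp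
qed

lemma second_difference_mean_value:
  fixes f g :: "'a::real_normed_vector \<Rightarrow> 'b::real_inner"
  assumes t: "t > 0"
    and box: "\<And>\<sigma> \<tau>. 0 \<le> \<sigma> \<Longrightarrow> \<sigma> \<le> t \<Longrightarrow> 0 \<le> \<tau> \<Longrightarrow> \<tau> \<le> t \<Longrightarrow> u + \<sigma> *\<^sub>R e1 + \<tau> *\<^sub>R e2 \<in> U"
    and f: "\<And>v. v \<in> U \<Longrightarrow> f differentiable at v"
    and g: "\<And>v. v \<in> U \<Longrightarrow> g differentiable at v"
    and g_eq: "\<And>v. v \<in> U \<Longrightarrow> g v = frechet_derivative f (at v) e1"
  obtains \<sigma> \<tau> where "0 \<le> \<sigma>" "\<sigma> \<le> t" "0 \<le> \<tau>" "\<tau> \<le> t"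
    "w \<bullet> (f (u + t *\<^sub>R e1 + t *\<^sub>R e2) - f (u + t *\<^sub>R e1) - f (u + t *\<^sub>R e2) + f u)
       = t * t * (w \<bullet> frechet_derivative g (at (u + \<sigma> *\<^sub>R e1 + \<tau> *\<^sub>R e2)) e2)"
proof -
  define \<psi> where "\<psi> x = w \<bullet> f ((u + t *\<^sub>R e2) + x *\<^sub>R e1) - w \<bullet> f (u + x *\<^sub>R e1)" for x
  have shift: "(u + c *\<^sub>R e2) + x *\<^sub>R e1 = u + x *\<^sub>R e1 + c *\<^sub>R e2" for c x
    by (simp add: algebra_simps)
  have "DERIV \<psi> x :> w \<bullet> g (u + x *\<^sub>R e1 + t *\<^sub>R e2) - w \<bullet> g (u + x *\<^sub>R e1)"
    if "0 \<le> x" "x \<le> t" for x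
  proof -
    have "u + x *\<^sub>R e1 + t *\<^sub>R e2 \<in> U" "u + x *\<^sub>R e1 \<in> U"
      using box[of x t] box[of x 0] that t by auto
    then show ?thesis
      unfolding \<psi>_def using f g_eq
      by (intro DERIV_diff) (metis has_real_derivative_inner_along_line shift)+
  qed
  from MVT2[OF t this] obtain \<sigma> where \<sigma>: "0 < \<sigma>" "\<sigma> < t"
    and \<psi>_diff: "\<psi> t - \<psi> 0 = t * (w \<bullet> g (u + \<sigma> *\<^sub>R e1 + t *\<^sub>R e2) - w \<bullet> g (u + \<sigma> *\<^sub>R e1))"
    by auto
  define \<eta> where "\<eta> y = w \<bullet> g ((u + \<sigma> *\<^sub>R e1) + y *\<^sub>R e2)" for y
  have "DERIV \<eta> y :> w \<bullet> frechet_derivative g (at (u + \<sigma> *\<^sub>R e1 + y *\<^sub>R e2)) e2"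
    if "0 \<le> y" "y \<le> t" for y
    unfolding \<eta>_def using g box[of \<sigma> y] \<sigma> that
    by (intro has_real_derivative_inner_along_line) auto
  from MVT2[OF t this] obtain \<tau> where \<tau>: "0 < \<tau>" "\<tau> < t"
    and \<eta>_diff: "\<eta> t - \<eta> 0 = t * (w \<bullet> frechet_derivative g (at (u + \<sigma> *\<^sub>R e1 + \<tau> *\<^sub>R e2)) e2)"
    by auto
  have "w \<bullet> (f (u + t *\<^sub>R e1 + t *\<^sub>R e2) - f (u + t *\<^sub>R e1) - f (u + t *\<^sub>R e2) + f u) = \<psi> t - \<psi> 0"
    unfolding \<psi>_def by (simp add: algebra_simps inner_diff_right inner_add_right)
  also have "\<dots> = t * (\<eta> t - \<eta> 0)"
    unfolding \<psi>_diff \<eta>_def by (simp add: algebra_simps)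
  finally show ?thesis
    using that[of \<sigma> \<tau>] \<sigma> \<tau> \<eta>_diff by (simp add: mult.assoc)
qed

lemma eq_if_eq_at_nearby_points:
  fixes A B :: "'a::metric_space \<Rightarrow> real"
  assumes "isCont A u" "isCont B u"
    and near: "\<And>r. r > 0 \<Longrightarrow> \<exists>x y. dist x u < r \<and> dist y u < r \<and> A x = B y"
  shows "A u = B u"
proof (rule ccontr)
  assume "A u \<noteq> B u"
  define e where "e = \<bar>A u - B u\<bar> / 2"
  have "e > 0"
    using \<open>A u \<noteq> B u\<close> by (simp add: e_def)
  obtain dA where "dA > 0" and dA: "\<And>x. dist x u < dA \<Longrightarrow> dist (A x) (A u) < e"
    using assms(1) \<open>e > 0\<close> unfolding continuous_at_eps_delta by blast
  obtain dB where "dB > 0" and dB: "\<And>x. dist x u < dB \<Longrightarrow> dist (B x) (B u) < e"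
    using assms(2) \<open>e > 0\<close> unfolding continuous_at_eps_delta by blast
  obtain x y where "dist x u < min dA dB" "dist y u < min dA dB" "A x = B y"
    using near[of "min dA dB"] \<open>dA > 0\<close> \<open>dB > 0\<close> by auto
  moreover have "\<bar>A u - B u\<bar> \<le> \<bar>A x - A u\<bar> + \<bar>B y - B u\<bar>"
    using \<open>A x = B y\<close> by linarith
  ultimately show False
    using dA[of x] dB[of y] by (simp add: e_def dist_real_def)
qed

lemma dist_add_scaleR_axis_le:
  fixes u :: "real^'k::finite"
  shows "dist (u + \<sigma> *\<^sub>R axis p 1 + \<tau> *\<^sub>R axis q 1) u \<le> \<bar>\<sigma>\<bar> + \<bar>\<tau>\<bar>"
proof -
  have "dist (u + \<sigma> *\<^sub>R axis p 1 + \<tau> *\<^sub>R axis q 1) u = norm (\<sigma> *\<^sub>R axis p (1::real) + \<tau> *\<^sub>R axis q 1)"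
    by (simp add: dist_norm)
  also have "\<dots> \<le> norm (\<sigma> *\<^sub>R axis p (1::real)) + norm (\<tau> *\<^sub>R axis q (1::real))"
    by (rule norm_triangle_ineq)
  finally show ?thesis
    by simp
qed

lemma second_pds_eq_at_nearby_points:
  fixes f :: "real^'k::finite \<Rightarrow> 'b::real_inner"
  assumes U: "open U" "u \<in> U"
    and f: "\<And>v. v \<in> U \<Longrightarrow> f differentiable at v"
    and fi: "\<And>v. v \<in> U \<Longrightarrow> pd i f differentiable at v"
    and fj: "\<And>v. v \<in> U \<Longrightarrow> pd j f differentiable at v"
    and "r > 0"
  obtains x y where "dist x u < r" "dist y u < r" "w \<bullet> pd i (pd j f) x = w \<bullet> pd j (pd i f) y"
proof -
  obtain r0 where "r0 > 0" "ball u r0 \<subseteq> U"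
    using U openE by blast
  define t where "t = min r r0 / 4"
  have "t > 0"
    using \<open>r > 0\<close> \<open>r0 > 0\<close> by (simp add: t_def)
  have close: "dist (u + \<sigma> *\<^sub>R axis p 1 + \<tau> *\<^sub>R axis q 1) u < min r r0"
    if "0 \<le> \<sigma>" "\<sigma> \<le> t" "0 \<le> \<tau>" "\<tau> \<le> t" for \<sigma> \<tau> and p q :: 'k
    using dist_add_scaleR_axis_le[of u \<sigma> p \<tau> q] that \<open>t > 0\<close> by (simp add: t_def)
  have box: "u + \<sigma> *\<^sub>R axis p 1 + \<tau> *\<^sub>R axis q 1 \<in> U"
    if "0 \<le> \<sigma>" "\<sigma> \<le> t" "0 \<le> \<tau>" "\<tau> \<le> t" for \<sigma> \<tau> and p q :: 'k
    using close[OF that, of p q] \<open>ball u r0 \<subseteq> U\<close> by (auto simp: dist_commute)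
  have pd_i: "pd i f v = frechet_derivative f (at v) (axis i 1)"
    and pd_j: "pd j f v = frechet_derivative f (at v) (axis j 1)" for v
    by (simp_all add: pd_def)
  obtain \<sigma> \<tau> where \<sigma>\<tau>: "0 \<le> \<sigma>" "\<sigma> \<le> t" "0 \<le> \<tau>" "\<tau> \<le> t" and ij:
    "w \<bullet> (f (u + t *\<^sub>R axis i 1 + t *\<^sub>R axis j 1) - f (u + t *\<^sub>R axis i 1) - f (u + t *\<^sub>R axis j 1) + f u)
     = t * t * (w \<bullet> frechet_derivative (pd i f) (at (u + \<sigma> *\<^sub>R axis i 1 + \<tau> *\<^sub>R axis j 1)) (axis j 1))"
    by (rule second_difference_mean_value[OF \<open>t > 0\<close> box[where p = i and q = j] f fi pd_i])
  obtain \<sigma>' \<tau>' where \<sigma>'\<tau>': "0 \<le> \<sigma>'" "\<sigma>' \<le> t" "0 \<le> \<tau>'" "\<tau>' \<le> t" and ji: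
    "w \<bullet> (f (u + t *\<^sub>R axis j 1 + t *\<^sub>R axis i 1) - f (u + t *\<^sub>R axis j 1) - f (u + t *\<^sub>R axis i 1) + f u)
     = t * t * (w \<bullet> frechet_derivative (pd j f) (at (u + \<sigma>' *\<^sub>R axis j 1 + \<tau>' *\<^sub>R axis i 1)) (axis i 1))"
    by (rule second_difference_mean_value[OF \<open>t > 0\<close> box[where p = j and q = i] f fj pd_j])
  have "u + t *\<^sub>R axis j 1 + t *\<^sub>R axis i 1 = u + t *\<^sub>R axis i 1 + t *\<^sub>R (axis j 1 :: real^'k)"
    by (simp add: algebra_simps)
  then have eq: "w \<bullet> pd i (pd j f) (u + \<sigma>' *\<^sub>R axis j 1 + \<tau>' *\<^sub>R axis i 1)
      = w \<bullet> pd j (pd i f) (u + \<sigma> *\<^sub>R axis i 1 + \<tau> *\<^sub>R axis j 1)"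
    using ij ji \<open>t > 0\<close> unfolding pd_def[of _ "pd _ f"] by (simp add: algebra_simps)
  show ?thesis
    by (rule that[OF _ _ eq]) (use close[OF \<sigma>'\<tau>', of j i] close[OF \<sigma>\<tau>, of i j] in auto)
qed

lemma pd_commute:
  fixes f :: "real^'k::finite \<Rightarrow> 'b::real_inner"
  assumes U: "open U" "u \<in> U"
    and f: "\<And>v. v \<in> U \<Longrightarrow> f differentiable at v"
    and fi: "\<And>v. v \<in> U \<Longrightarrow> pd i f differentiable at v"
    and fj: "\<And>v. v \<in> U \<Longrightarrow> pd j f differentiable at v"
    and cont: "continuous_on U (pd j (pd i f))" "continuous_on U (pd i (pd j f))"
  shows "pd i (pd j f) u = pd j (pd i f) u"
proof -
  define w where "w = pd i (pd j f) u - pd j (pd i f) u"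
  have "w \<bullet> pd i (pd j f) u = w \<bullet> pd j (pd i f) u"
  proof (rule eq_if_eq_at_nearby_points[where A = "\<lambda>v. w \<bullet> pd i (pd j f) v" and B = "\<lambda>v. w \<bullet> pd j (pd i f) v"])
    show "isCont (\<lambda>v. w \<bullet> pd i (pd j f) v) u" "isCont (\<lambda>v. w \<bullet> pd j (pd i f) v) u"
      using cont U by (auto simp: continuous_on_eq_continuous_at intro!: continuous_intros)
    show "\<exists>x y. dist x u < r \<and> dist y u < r \<and> w \<bullet> pd i (pd j f) x = w \<bullet> pd j (pd i f) y" if "r > 0" for r
      using second_pds_eq_at_nearby_points[OF U f fi fj that] by metis
  qed
  then have "w \<bullet> w = 0"
    by (simp add: w_def inner_diff_left inner_diff_right)
  then show ?thesis
    by (simp add: w_def)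
qed

section \<open>Derivatives of determinants and inverse matrices\<close>

lemma matrix_inv_right:
  fixes A :: "'a::semiring_1^'n^'n"
  assumes "invertible A"
  shows "A ** matrix_inv A = mat 1"
  using assms someI_ex[of "\<lambda>A'. A ** A' = mat 1 \<and> A' ** A = mat 1"]
  unfolding invertible_def matrix_inv_def by blast

lemma matrix_inv_left:
  fixes A :: "'a::semiring_1^'n^'n"
  assumes "invertible A"
  shows "matrix_inv A ** A = mat 1"
  using assms someI_ex[of "\<lambda>A'. A ** A' = mat 1 \<and> A' ** A = mat 1"]
  unfolding invertible_def matrix_inv_def by blast

lemma transpose_matrix_inv_symmetric:
  fixes A :: "'a::comm_semiring_1^'n^'n"
  assumes "invertible A" "transpose A = A"
  shows "transpose (matrix_inv A) = matrix_inv A"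
proof -
  have "transpose (matrix_inv A) ** A = mat 1"
    by (metis assms matrix_inv_right matrix_transpose_mul transpose_mat)
  then have "transpose (matrix_inv A) = (transpose (matrix_inv A) ** A) ** matrix_inv A"
    by (metis assms(1) matrix_inv_right matrix_mul_assoc matrix_mul_rid)
  then show ?thesis
    by (simp add: \<open>transpose (matrix_inv A) ** A = mat 1\<close>)
qed

lemma matrix_inv_eq_cramer:
  fixes A :: "real^'n::finite^'n"
  assumes "invertible A"
  shows "matrix_inv A $ r $ c = det (\<chi> i j. if j = r then axis c 1 $ i else A $ i $ j) / det A"
proof -
  define x where "x = (\<chi> k. matrix_inv A $ k $ c)"
  have "(A *v x) $ i = (A ** matrix_inv A) $ i $ c" for i
    by (simp add: x_def matrix_vector_mult_def matrix_matrix_mult_def)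
  then have "A *v x = axis c 1"
    using matrix_inv_right[OF assms] by (simp add: vec_eq_iff mat_def axis_def)
  then have "x = (\<chi> k. det (\<chi> i j. if j = k then axis c 1 $ i else A $ i $ j) / det A)"
    using cramer[of A x "axis c 1"] assms invertible_det_nz by blast
  then show ?thesis
    by (simp add: x_def vec_eq_iff)
qed

lemma has_derivative_det:
  fixes M :: "'a::real_normed_vector \<Rightarrow> real^'n::finite^'n"
  assumes "\<And>r c. ((\<lambda>v. M v $ r $ c) has_derivative M' r c) (at u)"
  shows "((\<lambda>v. det (M v)) has_derivative
     (\<lambda>d. \<Sum>i\<in>UNIV. det (\<chi> r. if r = i then (\<chi> c. M' i c d) else row r (M u)))) (at u)"
proof -
  have "((\<lambda>v. det (M v)) has_derivative (\<lambda>d. \<Sum>p\<in>{p. p permutes UNIV}. of_int (sign p) *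
      (\<Sum>i\<in>UNIV. M' i (p i) d * (\<Prod>j\<in>UNIV - {i}. M u $ j $ p j)))) (at u)"
    unfolding det_def by (intro has_derivative_sum has_derivative_mult_right has_derivative_prod assms)
  moreover have "(\<lambda>d. \<Sum>p\<in>{p. p permutes UNIV}. of_int (sign p) *
      (\<Sum>i\<in>UNIV. M' i (p i) d * (\<Prod>j\<in>UNIV - {i}. M u $ j $ p j)))
    = (\<lambda>d. \<Sum>i\<in>UNIV. det (\<chi> r. if r = i then (\<chi> c. M' i c d) else row r (M u)))"
  proof
    fix d
    have row_i: "(\<Prod>r\<in>UNIV. (\<chi> r. if r = i then (\<chi> c. M' i c d) else row r (M u)) $ r $ p r)
        = M' i (p i) d * (\<Prod>j\<in>UNIV - {i}. M u $ j $ p j)" for i p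
      by (subst prod.remove[of _ i]) (auto simp: row_def intro!: prod.cong)
    show "(\<Sum>p\<in>{p. p permutes UNIV}. of_int (sign p) *
        (\<Sum>i\<in>UNIV. M' i (p i) d * (\<Prod>j\<in>UNIV - {i}. M u $ j $ p j)))
      = (\<Sum>i\<in>UNIV. det (\<chi> r. if r = i then (\<chi> c. M' i c d) else row r (M u)))"
      unfolding det_def row_i sum_distrib_left by (rule sum.swap)
  qed
  ultimately show ?thesis
    by (rule has_derivative_eq_rhs)
qed

lemma det_replace_row:
  fixes A :: "real^'n::finite^'n"
  assumes "invertible A"
  shows "det (\<chi> r. if r = i then v else row r A) = (\<Sum>b\<in>UNIV. v $ b * matrix_inv A $ b $ i) * det A"
proof -
  define x where "x = v v* matrix_inv A"
  have "v = x v* A"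
    by (simp add: x_def vector_matrix_mul_assoc matrix_inv_left[OF assms])
  also have "\<dots> = (\<Sum>a\<in>UNIV. x $ a *s row a A)"
    by (simp add: vec_eq_iff vector_matrix_mult_def row_def sum_component mult.commute)
  finally have "det (\<chi> r. if r = i then v else row r A) = x $ i * det A"
    by (simp only: cramer_lemma_transpose)
  then show ?thesis
    by (simp add: x_def vector_matrix_mult_def)
qed

lemma has_derivative_det_jacobi:
  fixes M :: "'a::real_normed_vector \<Rightarrow> real^'n::finite^'n"
  assumes "\<And>r c. ((\<lambda>v. M v $ r $ c) has_derivative M' r c) (at u)" "invertible (M u)"
  shows "((\<lambda>v. det (M v)) has_derivative
     (\<lambda>d. det (M u) * (\<Sum>i\<in>UNIV. \<Sum>b\<in>UNIV. M' i b d * matrix_inv (M u) $ b $ i))) (at u)"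
  using has_derivative_det[OF assms(1)]
  by (rule has_derivative_eq_rhs) (simp add: det_replace_row[OF assms(2)] sum_distrib_left mult.commute fun_eq_iff)

lemma has_derivative_sqrt_nonzero:
  fixes f :: "'a::real_normed_vector \<Rightarrow> real"
  assumes "(f has_derivative f') (at u)" "f u \<noteq> 0"
  shows "((\<lambda>v. sqrt (f v)) has_derivative (\<lambda>d. sqrt (f u) / (2 * f u) * f' d)) (at u)"
proof -
  have "DERIV sqrt (f u) :> sqrt (f u) / (2 * f u)"
  proof (rule DERIV_real_sqrt_generic)
    show "f u \<noteq> 0" by fact
    show "0 < f u \<Longrightarrow> sqrt (f u) / (2 * f u) = inverse (sqrt (f u)) / 2"
      by (simp add: field_simps)
    show "f u < 0 \<Longrightarrow> sqrt (f u) / (2 * f u) = - inverse (sqrt (f u)) / 2"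
      using real_sqrt_mult_self[of "f u"] by (simp add: field_simps real_sqrt_minus)
  qed
  from DERIV_compose_FDERIV[OF this assms(1)] show ?thesis
    by (simp add: mult.commute)
qed

lemma has_derivative_sqrt_det:
  fixes M :: "'a::real_normed_vector \<Rightarrow> real^'n::finite^'n"
  assumes "\<And>r c. ((\<lambda>v. M v $ r $ c) has_derivative M' r c) (at u)" "invertible (M u)"
  shows "((\<lambda>v. sqrt (det (M v))) has_derivative
     (\<lambda>d. sqrt (det (M u)) / 2 * (\<Sum>i\<in>UNIV. \<Sum>b\<in>UNIV. M' i b d * matrix_inv (M u) $ b $ i))) (at u)"
  using has_derivative_sqrt_nonzero[OF has_derivative_det_jacobi[OF assms]] invertible_det_nz[of "M u"] assms(2)
  by (simp add: field_simps)

lemma matrix_inv_entry_differentiable: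
  fixes M :: "'a::real_normed_vector \<Rightarrow> real^'n::finite^'n"
  assumes U: "open U" "u \<in> U" and inv: "\<And>v. v \<in> U \<Longrightarrow> invertible (M v)"
    and M': "\<And>r c. ((\<lambda>v. M v $ r $ c) has_derivative M' r c) (at u)"
  shows "(\<lambda>v. matrix_inv (M v) $ r $ c) differentiable at u"
proof -
  define N where "N v = ((\<chi> i j. if j = r then axis c 1 $ i else M v $ i $ j) :: real^'n^'n)" for v
  have N': "((\<lambda>v. N v $ i $ j) has_derivative (if j = r then (\<lambda>d. 0) else M' i j)) (at u)" for i j
    using M'[of i j] by (simp add: N_def)
  have "(\<lambda>v. det (N v)) differentiable at u"
    unfolding differentiable_def using has_derivative_det[OF N'] by blast
  moreover have "(\<lambda>v. det (M v)) differentiable at u"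
    using has_derivative_det[OF M'] differentiable_def by blast
  ultimately have "(\<lambda>v. det (N v) / det (M v)) differentiable at u"
    using U inv invertible_det_nz by (intro differentiable_divide) auto
  then obtain f' where "((\<lambda>v. det (N v) / det (M v)) has_derivative f') (at u)"
    unfolding differentiable_def by blast
  then have "((\<lambda>v. matrix_inv (M v) $ r $ c) has_derivative f') (at u)"
    by (rule has_derivative_transform_within_open[OF _ U]) (simp add: N_def matrix_inv_eq_cramer inv)
  then show ?thesis
    unfolding differentiable_def by blast
qed

lemma matrix_inv_derivative_mult:
  fixes M :: "'a::real_normed_vector \<Rightarrow> real^'n::finite^'n"
  assumes U: "open U" "u \<in> U" and inv: "\<And>v. v \<in> U \<Longrightarrow> invertible (M v)"
    and M': "\<And>r c. ((\<lambda>v. M v $ r $ c) has_derivative M' r c) (at u)"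
    and G': "\<And>r c. ((\<lambda>v. matrix_inv (M v) $ r $ c) has_derivative G' r c) (at u)"
  shows "(\<chi> r c. G' r c d) ** M u = - (matrix_inv (M u) ** (\<chi> r c. M' r c d))"
proof -
  have "(\<Sum>b\<in>UNIV. matrix_inv (M u) $ a $ b * M' b c d + G' a b d * M u $ b $ c) = 0" for a c
  proof -
    have "((\<lambda>v. \<Sum>b\<in>UNIV. matrix_inv (M v) $ a $ b * M v $ b $ c) has_derivative
        (\<lambda>d. \<Sum>b\<in>UNIV. matrix_inv (M u) $ a $ b * M' b c d + G' a b d * M u $ b $ c)) (at u)"
      by (intro has_derivative_sum has_derivative_mult G' M')
    moreover have "((\<lambda>v. \<Sum>b\<in>UNIV. matrix_inv (M v) $ a $ b * M v $ b $ c) has_derivative (\<lambda>d. 0)) (at u)"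
    proof (rule has_derivative_transform_within_open[OF _ U])
      show "((\<lambda>v. (mat 1 :: real^'n^'n) $ a $ c) has_derivative (\<lambda>d. 0)) (at u)"
        by simp
      show "(mat 1 :: real^'n^'n) $ a $ c = (\<Sum>b\<in>UNIV. matrix_inv (M v) $ a $ b * M v $ b $ c)"
        if "v \<in> U" for v
        using matrix_inv_left[OF inv[OF that]] by (simp add: matrix_matrix_mult_def vec_eq_iff)
    qed
    ultimately have "(\<lambda>d. \<Sum>b\<in>UNIV. matrix_inv (M u) $ a $ b * M' b c d + G' a b d * M u $ b $ c) = (\<lambda>d. 0)"
      by (rule has_derivative_unique)
    from fun_cong[OF this, of d] show ?thesis
      by simp
  qed
  then show ?thesis
    by (simp add: vec_eq_iff matrix_matrix_mult_def sum.distrib eq_neg_iff_add_eq_0 add.commute)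
qed

lemma has_derivative_matrix_inv:
  fixes M :: "'a::real_normed_vector \<Rightarrow> real^'n::finite^'n"
  assumes U: "open U" "u \<in> U" and inv: "\<And>v. v \<in> U \<Longrightarrow> invertible (M v)"
    and M': "\<And>r c. ((\<lambda>v. M v $ r $ c) has_derivative M' r c) (at u)"
  shows "((\<lambda>v. matrix_inv (M v) $ r $ c) has_derivative
     (\<lambda>d. - (\<Sum>e\<in>UNIV. \<Sum>b\<in>UNIV. matrix_inv (M u) $ r $ e * M' e b d * matrix_inv (M u) $ b $ c))) (at u)"
proof -
  let ?G = "matrix_inv (M u)"
  define G' where "G' a b = frechet_derivative (\<lambda>v. matrix_inv (M v) $ a $ b) (at u)" for a b
  have G': "((\<lambda>v. matrix_inv (M v) $ a $ b) has_derivative G' a b) (at u)" for a b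
    unfolding G'_def using matrix_inv_entry_differentiable[OF assms] frechet_derivative_works by blast
  have "G' r c d = - (\<Sum>e\<in>UNIV. \<Sum>b\<in>UNIV. ?G $ r $ e * M' e b d * ?G $ b $ c)" for d
  proof -
    have "(\<chi> a c. G' a c d) = (\<chi> a c. G' a c d) ** (M u ** ?G)"
      by (simp add: matrix_inv_right[OF inv[OF U(2)]])
    also have "\<dots> = - (?G ** (\<chi> a c. M' a c d)) ** ?G"
      by (simp add: matrix_mul_assoc matrix_inv_derivative_mult[OF assms G'])
    finally show ?thesis
      by (simp add: vec_eq_iff matrix_matrix_mult_def sum_distrib_right sum_negf) (rule sum.swap)
  qed
  then have "G' r c = (\<lambda>d. - (\<Sum>e\<in>UNIV. \<Sum>b\<in>UNIV. ?G $ r $ e * M' e b d * ?G $ b $ c))"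
    by (rule ext)
  then show ?thesis
    using G'[of r c] by simp
qed

section \<open>The induced metric and the Laplace-Beltrami operator\<close>

lemma smooth_on_pds_differentiable:
  assumes "smooth_on U f" "open U" "v \<in> U"
  shows "pds is f differentiable at v"
  using assms unfolding smooth_on_def by (meson differentiable_on_eq_differentiable_at)

lemma immersion_on_differentiable:
  assumes "immersion_on U \<phi>" "v \<in> U"
  shows "\<phi> differentiable at v" "pd j \<phi> differentiable at v" "pd i (pd j \<phi>) differentiable at v"
  using assms smooth_on_pds_differentiable[of U \<phi> v "[]"] smooth_on_pds_differentiable[of U \<phi> v "[j]"]
    smooth_on_pds_differentiable[of U \<phi> v "[i, j]"]
  unfolding immersion_on_def by auto

lemma immersion_on_pd_commute:
  assumes "immersion_on U \<phi>" "u \<in> U"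
  shows "pd i (pd j \<phi>) u = pd j (pd i \<phi>) u"
proof -
  have "open U"
    using assms(1) by (simp add: immersion_on_def)
  have cont: "continuous_on U (pd p (pd q \<phi>))" for p q
    using immersion_on_differentiable[OF assms(1)] \<open>open U\<close>
    by (meson differentiable_imp_continuous_on differentiable_on_eq_differentiable_at)
  show ?thesis
    by (rule pd_commute[OF \<open>open U\<close> assms(2) _ _ _ cont cont])
      (simp_all add: immersion_on_differentiable[OF assms(1)])
qed

lemma transpose_metric: "transpose (metric \<phi> u) = metric \<phi> u"
  by (simp add: metric_def transpose_def vec_eq_iff inner_commute)

lemma metric_invertible:
  fixes \<phi> :: "real^'k::finite \<Rightarrow> real^'m::finite"
  assumes d: "\<phi> differentiable at u" and inj: "inj (frechet_derivative \<phi> (at u))"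
  shows "invertible (metric \<phi> u)"
proof -
  let ?D = "frechet_derivative \<phi> (at u)"
  have "x = 0" if "metric \<phi> u *v x = 0" for x
  proof -
    have metric: "metric \<phi> u $ i $ j = pd j \<phi> u \<bullet> pd i \<phi> u" for i j
      by (simp add: metric_def inner_commute)
    have "?D x \<bullet> ?D x = (\<Sum>i\<in>UNIV. \<Sum>j\<in>UNIV. x $ i * (x $ j * (pd j \<phi> u \<bullet> pd i \<phi> u)))"
      unfolding frechet_derivative_eq_sum_pd[OF d] by (simp add: inner_sum_left inner_sum_right sum_distrib_left)
    also have "\<dots> = (\<Sum>i\<in>UNIV. x $ i * (metric \<phi> u *v x) $ i)"
      by (simp add: matrix_vector_mult_def metric sum_distrib_left mult_ac)
    also have "\<dots> = x \<bullet> (metric \<phi> u *v x)"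
      by (simp add: inner_vec_def[of x] inner_real_def)
    finally have "?D x \<bullet> ?D x = 0"
      using that by simp
    then have "?D x = ?D 0"
      using d linear_0 linear_frechet_derivative by fastforce
    then show "x = 0"
      using inj by (meson injD)
  qed
  then obtain B where "B ** metric \<phi> u = mat 1"
    using matrix_left_invertible_ker by blast
  then show ?thesis
    unfolding invertible_def using matrix_left_right_inverse by blast
qed

lemma immersion_on_metric_invertible:
  assumes "immersion_on U \<phi>" "u \<in> U"
  shows "invertible (metric \<phi> u)"
proof (rule metric_invertible)
  show "\<phi> differentiable at u"
    using immersion_on_differentiable(1)[OF assms] .
  show "inj (frechet_derivative \<phi> (at u))"
    using assms by (simp add: immersion_on_def)
qed

lemma inv_metric_commute:
  assumes "invertible (metric \<phi> u)"
  shows "inv_metric \<phi> u $ i $ j = inv_metric \<phi> u $ j $ i"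
proof -
  have "transpose (inv_metric \<phi> u) = inv_metric \<phi> u"
    unfolding inv_metric_def by (rule transpose_matrix_inv_symmetric[OF assms transpose_metric])
  from arg_cong[OF this, of "\<lambda>A. A $ i $ j"] show ?thesis
    by (simp add: transpose_def)
qed

lemma inv_metric_metric:
  assumes "invertible (metric \<phi> u)"
  shows "(\<Sum>i\<in>UNIV. inv_metric \<phi> u $ j $ i * (pd i \<phi> u \<bullet> pd l \<phi> u)) = (if j = l then 1 else 0)"
  using arg_cong[OF matrix_inv_left[OF assms], of "\<lambda>A. A $ j $ l"]
  by (simp add: inv_metric_def matrix_matrix_mult_def metric_def mat_def)

lemma has_derivative_metric:
  assumes "pd j \<phi> differentiable at u" "pd k \<phi> differentiable at u"
  shows "((\<lambda>v. metric \<phi> v $ j $ k) has_derivative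
     (\<lambda>d. pd j \<phi> u \<bullet> frechet_derivative (pd k \<phi>) (at u) d + frechet_derivative (pd j \<phi>) (at u) d \<bullet> pd k \<phi> u))
     (at u)"
  unfolding metric_def using assms by (simp add: frechet_derivative_works has_derivative_inner)

definition christoffel :: "(real^'k::finite \<Rightarrow> real^'m::finite) \<Rightarrow> real^'k \<Rightarrow> 'k \<Rightarrow> 'k \<Rightarrow> 'k \<Rightarrow> real" where
  "christoffel \<phi> u i j l = (\<Sum>k\<in>UNIV. inv_metric \<phi> u $ k $ l * (pd i (pd j \<phi>) u \<bullet> pd k \<phi> u))"

lemma mean_curvature_vec_christoffel:
  "mean_curvature_vec \<phi> u = (\<Sum>i\<in>UNIV. \<Sum>j\<in>UNIV. inv_metric \<phi> u $ i $ j *\<^sub>R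
      (pd i (pd j \<phi>) u - (\<Sum>l\<in>UNIV. christoffel \<phi> u i j l *\<^sub>R pd l \<phi> u)))"
proof -
  have "tangent_proj \<phi> u v = (\<Sum>l\<in>UNIV. (\<Sum>k\<in>UNIV. inv_metric \<phi> u $ k $ l * (v \<bullet> pd k \<phi> u)) *\<^sub>R pd l \<phi> u)"
    for v
    unfolding tangent_proj_def scaleR_sum_left by (rule sum.swap)
  then show ?thesis
    unfolding mean_curvature_vec_def christoffel_def by simp
qed

lemma sum_rotate3:
  "(\<Sum>i\<in>A. \<Sum>a\<in>B. \<Sum>b\<in>C. f i a b) = (\<Sum>a\<in>B. \<Sum>b\<in>C. \<Sum>i\<in>A. f i a b)"
  by (subst sum.swap) (rule sum.cong[OF refl], rule sum.swap)

text \<open>The coordinate identity \<open>(1/\<surd>g) \<partial>\<^sub>i(\<surd>g g\<^sup>i\<^sup>l) = - g\<^sup>i\<^sup>j \<Gamma>\<^sup>l\<^sub>i\<^sub>j\<close>, with \<open>\<partial>\<^sub>i g\<^sub>a\<^sub>b\<close>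
  and \<open>\<partial>\<^sub>i g\<^sup>a\<^sup>b\<close> expanded in terms of \<open>P = \<partial>\<phi>\<close>, \<open>Q = \<partial>\<^sup>2\<phi>\<close> and \<open>G = g\<^sup>-\<^sup>1\<close>.\<close>

lemma contracted_christoffel_identity:
  fixes P :: "'k::finite \<Rightarrow> 'a::real_inner" and Q :: "'k \<Rightarrow> 'k \<Rightarrow> 'a" and G :: "'k \<Rightarrow> 'k \<Rightarrow> real"
  assumes Q: "\<And>i j. Q i j = Q j i" and G: "\<And>i j. G i j = G j i"
  shows "(\<Sum>i\<in>UNIV. (\<Sum>a\<in>UNIV. \<Sum>b\<in>UNIV. (P a \<bullet> Q i b + Q i a \<bullet> P b) * G b a) / 2 * G i l
          - (\<Sum>a\<in>UNIV. \<Sum>b\<in>UNIV. G i a * (P a \<bullet> Q i b + Q i a \<bullet> P b) * G b l))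
       = - (\<Sum>i\<in>UNIV. \<Sum>j\<in>UNIV. G i j * (\<Sum>k\<in>UNIV. G k l * (Q i j \<bullet> P k)))"
proof -
  have half: "(\<Sum>a\<in>UNIV. \<Sum>b\<in>UNIV. (P a \<bullet> Q i b + Q i a \<bullet> P b) * G b a) / 2
      = (\<Sum>a\<in>UNIV. \<Sum>b\<in>UNIV. (Q i a \<bullet> P b) * G b a)" for i
  proof -
    have "(\<Sum>a\<in>UNIV. \<Sum>b\<in>UNIV. (P a \<bullet> Q i b) * G b a) = (\<Sum>a\<in>UNIV. \<Sum>b\<in>UNIV. (Q i a \<bullet> P b) * G b a)"
      by (subst sum.swap) (simp add: G inner_commute)
    then show ?thesis
      by (simp add: distrib_right sum.distrib)
  qed
  have "(\<Sum>i\<in>UNIV. (\<Sum>a\<in>UNIV. \<Sum>b\<in>UNIV. (Q i a \<bullet> P b) * G b a) * G i l)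
      = (\<Sum>i\<in>UNIV. \<Sum>a\<in>UNIV. \<Sum>b\<in>UNIV. (Q i a \<bullet> P b) * G b a * G i l)"
    by (simp add: sum_distrib_right)
  also have "\<dots> = (\<Sum>a\<in>UNIV. \<Sum>b\<in>UNIV. \<Sum>i\<in>UNIV. (Q i a \<bullet> P b) * G b a * G i l)"
    by (rule sum_rotate3)
  also have "\<dots> = (\<Sum>i\<in>UNIV. \<Sum>a\<in>UNIV. \<Sum>b\<in>UNIV. G i a * (P a \<bullet> Q i b) * G b l)"
    by (simp add: Q G inner_commute mult_ac)
  finally have swap: "(\<Sum>i\<in>UNIV. (\<Sum>a\<in>UNIV. \<Sum>b\<in>UNIV. (Q i a \<bullet> P b) * G b a) * G i l)
      = (\<Sum>i\<in>UNIV. \<Sum>a\<in>UNIV. \<Sum>b\<in>UNIV. G i a * (P a \<bullet> Q i b) * G b l)" .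
  have "(\<Sum>i\<in>UNIV. \<Sum>j\<in>UNIV. G i j * (\<Sum>k\<in>UNIV. G k l * (Q i j \<bullet> P k)))
      = (\<Sum>i\<in>UNIV. \<Sum>a\<in>UNIV. \<Sum>b\<in>UNIV. G i a * (Q i a \<bullet> P b) * G b l)"
    by (simp add: sum_distrib_left mult_ac)
  with swap show ?thesis
    unfolding half sum_subtractf by (simp add: distrib_left distrib_right sum.distrib)
qed

definition metric_pd :: "(real^'k::finite \<Rightarrow> real^'m::finite) \<Rightarrow> real^'k \<Rightarrow> 'k \<Rightarrow> 'k \<Rightarrow> 'k \<Rightarrow> real" where
  "metric_pd \<phi> u i a b = pd a \<phi> u \<bullet> pd i (pd b \<phi>) u + pd i (pd a \<phi>) u \<bullet> pd b \<phi> u"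

text \<open>The product rule applied to the divergence \<open>\<partial>\<^sub>i(\<surd>g g\<^sup>i\<^sup>j \<partial>\<^sub>j h)\<close>, using
  \<open>\<partial>\<^sub>i \<surd>g = \<surd>g tr(g\<^sup>-\<^sup>1 \<partial>\<^sub>i g) / 2\<close> and \<open>\<partial>\<^sub>i g\<^sup>-\<^sup>1 = - g\<^sup>-\<^sup>1 (\<partial>\<^sub>i g) g\<^sup>-\<^sup>1\<close>.\<close>

lemma laplace_beltrami_expand:
  fixes \<phi> :: "real^'k::finite \<Rightarrow> real^'m::finite" and h :: "real^'k \<Rightarrow> real"
  assumes \<phi>: "immersion_on U \<phi>" "u \<in> U" and h: "\<And>j. pd j h differentiable at u"
  shows "laplace_beltrami \<phi> h u = (\<Sum>i\<in>UNIV.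
      (\<Sum>j\<in>UNIV. inv_metric \<phi> u $ i $ j * pd i (pd j h) u
         - (\<Sum>e\<in>UNIV. \<Sum>b\<in>UNIV. inv_metric \<phi> u $ i $ e * metric_pd \<phi> u i e b * inv_metric \<phi> u $ b $ j)
           * pd j h u)
      + (\<Sum>a\<in>UNIV. \<Sum>b\<in>UNIV. metric_pd \<phi> u i a b * inv_metric \<phi> u $ b $ a) / 2
        * (\<Sum>j\<in>UNIV. inv_metric \<phi> u $ i $ j * pd j h u))"
proof -
  let ?D = "det (metric \<phi> u)" and ?G = "\<lambda>i j. inv_metric \<phi> u $ i $ j"
  define g' where "g' j k d = pd j \<phi> u \<bullet> frechet_derivative (pd k \<phi>) (at u) d
      + frechet_derivative (pd j \<phi>) (at u) d \<bullet> pd k \<phi> u" for j k d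
  have "open U"
    using \<phi>(1) by (simp add: immersion_on_def)
  have inv: "invertible (metric \<phi> v)" if "v \<in> U" for v
    using immersion_on_metric_invertible \<phi>(1) that .
  have "?D \<noteq> 0"
    using invertible_det_nz inv \<phi>(2) by blast
  have g': "((\<lambda>v. metric \<phi> v $ j $ k) has_derivative g' j k) (at u)" for j k
    unfolding g'_def using has_derivative_metric immersion_on_differentiable \<phi> by blast
  have g'_axis: "g' a b (axis i 1) = metric_pd \<phi> u i a b" for i a b
    by (simp add: g'_def metric_pd_def pd_def)
  have sqrt_det: "((\<lambda>v. sqrt (det (metric \<phi> v))) has_derivative
      (\<lambda>d. sqrt ?D / 2 * (\<Sum>a\<in>UNIV. \<Sum>b\<in>UNIV. g' a b d * ?G b a))) (at u)"
    using has_derivative_sqrt_det[OF g' inv[OF \<phi>(2)]] unfolding inv_metric_def .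
  have inv_metric: "((\<lambda>v. inv_metric \<phi> v $ i $ j) has_derivative
      (\<lambda>d. - (\<Sum>e\<in>UNIV. \<Sum>b\<in>UNIV. ?G i e * g' e b d * ?G b j))) (at u)" for i j
    using has_derivative_matrix_inv[OF \<open>open U\<close> \<phi>(2) inv g'] unfolding inv_metric_def .
  have "((\<lambda>v. sqrt (det (metric \<phi> v)) * (\<Sum>j\<in>UNIV. inv_metric \<phi> v $ i $ j * pd j h v)) has_derivative
      (\<lambda>d. sqrt ?D * (\<Sum>j\<in>UNIV. ?G i j * frechet_derivative (pd j h) (at u) d
            + - (\<Sum>e\<in>UNIV. \<Sum>b\<in>UNIV. ?G i e * g' e b d * ?G b j) * pd j h u)
        + sqrt ?D / 2 * (\<Sum>a\<in>UNIV. \<Sum>b\<in>UNIV. g' a b d * ?G b a) * (\<Sum>j\<in>UNIV. ?G i j * pd j h u)))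
      (at u)" for i
    using h by (intro has_derivative_mult has_derivative_sum sqrt_det inv_metric)
      (simp add: frechet_derivative_works)
  from pd_eq_has_derivative[OF this]
  have "pd i (\<lambda>v. sqrt (det (metric \<phi> v)) * (\<Sum>j\<in>UNIV. inv_metric \<phi> v $ i $ j * pd j h v)) u
      = sqrt ?D * (\<Sum>j\<in>UNIV. ?G i j * pd i (pd j h) u
          - (\<Sum>e\<in>UNIV. \<Sum>b\<in>UNIV. ?G i e * metric_pd \<phi> u i e b * ?G b j) * pd j h u)
        + sqrt ?D / 2 * (\<Sum>a\<in>UNIV. \<Sum>b\<in>UNIV. metric_pd \<phi> u i a b * ?G b a) * (\<Sum>j\<in>UNIV. ?G i j * pd j h u)"
    for i
    by (simp add: g'_axis pd_def[of i "pd _ h"])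
  moreover have "1 / sqrt ?D * (sqrt ?D * x + sqrt ?D / 2 * y * z) = x + y / 2 * z" for x y z
    using \<open>?D \<noteq> 0\<close> by (simp add: field_simps)
  ultimately show ?thesis
    unfolding laplace_beltrami_def sum_distrib_left[of "1 / sqrt ?D"] by simp
qed

lemma laplace_beltrami_coordinates:
  fixes \<phi> :: "real^'k::finite \<Rightarrow> real^'m::finite" and h :: "real^'k \<Rightarrow> real"
  assumes \<phi>: "immersion_on U \<phi>" "u \<in> U" and h: "\<And>j. pd j h differentiable at u"
  shows "laplace_beltrami \<phi> h u = (\<Sum>i\<in>UNIV. \<Sum>j\<in>UNIV. inv_metric \<phi> u $ i $ j *
      (pd i (pd j h) u - (\<Sum>l\<in>UNIV. christoffel \<phi> u i j l * pd l h u)))"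
proof -
  let ?G = "\<lambda>i j. inv_metric \<phi> u $ i $ j" and ?w = "\<lambda>j. pd j h u"
  let ?H = "\<Sum>i\<in>UNIV. \<Sum>j\<in>UNIV. ?G i j * pd i (pd j h) u"
  define T where "T i = (\<Sum>a\<in>UNIV. \<Sum>b\<in>UNIV. metric_pd \<phi> u i a b * ?G b a)" for i
  define C where "C i j = (\<Sum>e\<in>UNIV. \<Sum>b\<in>UNIV. ?G i e * metric_pd \<phi> u i e b * ?G b j)" for i j
  have inv: "invertible (metric \<phi> u)"
    using immersion_on_metric_invertible[OF \<phi>] .
  have christoffel_sum: "(\<Sum>i\<in>UNIV. T i / 2 * ?G i l - C i l)
      = - (\<Sum>i\<in>UNIV. \<Sum>j\<in>UNIV. ?G i j * christoffel \<phi> u i j l)" for l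
    using contracted_christoffel_identity[where P = "\<lambda>j. pd j \<phi> u" and Q = "\<lambda>i j. pd i (pd j \<phi>) u"
        and G = ?G and l = l, OF immersion_on_pd_commute[OF \<phi>] inv_metric_commute[OF inv]]
    by (simp add: T_def C_def metric_pd_def christoffel_def)
  have "laplace_beltrami \<phi> h u
      = (\<Sum>i\<in>UNIV. (\<Sum>j\<in>UNIV. ?G i j * pd i (pd j h) u - C i j * ?w j) + T i / 2 * (\<Sum>j\<in>UNIV. ?G i j * ?w j))"
    unfolding T_def C_def by (rule laplace_beltrami_expand[OF \<phi> h])
  also have "\<dots> = ?H + (\<Sum>i\<in>UNIV. \<Sum>l\<in>UNIV. (T i / 2 * ?G i l - C i l) * ?w l)"
    by (simp add: sum.distrib sum_distrib_left sum_subtractf algebra_simps)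
  also have "\<dots> = ?H + (\<Sum>l\<in>UNIV. (\<Sum>i\<in>UNIV. T i / 2 * ?G i l - C i l) * ?w l)"
    by (subst sum.swap) (simp add: sum_distrib_right)
  also have "\<dots> = ?H - (\<Sum>l\<in>UNIV. \<Sum>i\<in>UNIV. \<Sum>j\<in>UNIV. ?G i j * christoffel \<phi> u i j l * ?w l)"
    unfolding christoffel_sum by (simp add: sum_distrib_right sum_negf)
  also have "\<dots> = ?H - (\<Sum>i\<in>UNIV. \<Sum>j\<in>UNIV. ?G i j * (\<Sum>l\<in>UNIV. christoffel \<phi> u i j l * ?w l))"
    by (subst sum_rotate3) (simp add: sum_distrib_left mult.assoc)
  finally show ?thesis
    by (simp add: right_diff_distrib sum_subtractf)
qed

lemma pd_comp_gradient:
  fixes \<phi> :: "real^'k::finite \<Rightarrow> real^'m::finite" and h :: "real^'m \<Rightarrow> real"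
  assumes "\<And>x. (h has_derivative (\<lambda>y. W x \<bullet> y)) (at x)" "\<phi> differentiable at v"
  shows "pd j (h \<circ> \<phi>) v = W (\<phi> v) \<bullet> pd j \<phi> v"
proof -
  have "((h \<circ> \<phi>) has_derivative (\<lambda>y. W (\<phi> v) \<bullet> y) \<circ> frechet_derivative \<phi> (at v)) (at v)"
    using diff_chain_at assms frechet_derivative_works by blast
  from pd_eq_has_derivative[OF this, of j] show ?thesis
    by (simp add: pd_def[of j \<phi>])
qed

lemma laplace_beltrami_comp:
  fixes \<phi> :: "real^'k::finite \<Rightarrow> real^'m::finite" and h :: "real^'m \<Rightarrow> real"
  assumes \<phi>: "immersion_on U \<phi>" "u \<in> U"
    and h: "\<And>x. (h has_derivative (\<lambda>y. W x \<bullet> y)) (at x)"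
    and W: "(W has_derivative W') (at (\<phi> u))"
  shows "laplace_beltrami \<phi> (h \<circ> \<phi>) u =
      (\<Sum>i\<in>UNIV. \<Sum>j\<in>UNIV. inv_metric \<phi> u $ i $ j * (W' (pd i \<phi> u) \<bullet> pd j \<phi> u))
      + W (\<phi> u) \<bullet> mean_curvature_vec \<phi> u"
proof -
  have "open U"
    using \<phi>(1) by (simp add: immersion_on_def)
  have grad: "pd j (h \<circ> \<phi>) v = W (\<phi> v) \<bullet> pd j \<phi> v" if "v \<in> U" for j v
    using pd_comp_gradient[OF h immersion_on_differentiable(1)[OF \<phi>(1) that]] .
  have D\<phi>: "(\<phi> has_derivative frechet_derivative \<phi> (at u)) (at u)"
    and DP: "(pd j \<phi> has_derivative frechet_derivative (pd j \<phi>) (at u)) (at u)" for j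
    using immersion_on_differentiable[OF \<phi>] frechet_derivative_works by blast+
  have "((\<lambda>v. W (\<phi> v) \<bullet> pd j \<phi> v) has_derivative (\<lambda>d. W (\<phi> u) \<bullet> frechet_derivative (pd j \<phi>) (at u) d
      + W' (frechet_derivative \<phi> (at u) d) \<bullet> pd j \<phi> u)) (at u)" for j
    using has_derivative_inner[OF has_derivative_compose[OF D\<phi> W] DP] .
  then have D_grad: "(pd j (h \<circ> \<phi>) has_derivative (\<lambda>d. W (\<phi> u) \<bullet> frechet_derivative (pd j \<phi>) (at u) d
      + W' (frechet_derivative \<phi> (at u) d) \<bullet> pd j \<phi> u)) (at u)" for j
    by (rule has_derivative_transform_within_open[OF _ \<open>open U\<close> \<phi>(2)]) (simp add: grad)
  have hessian: "pd i (pd j (h \<circ> \<phi>)) u = W (\<phi> u) \<bullet> pd i (pd j \<phi>) u + W' (pd i \<phi> u) \<bullet> pd j \<phi> u" for i j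
    using pd_eq_has_derivative[OF D_grad, of i] by (simp only: pd_def)
  have "pd j (h \<circ> \<phi>) differentiable at u" for j
    using D_grad differentiable_def by blast
  then have "laplace_beltrami \<phi> (h \<circ> \<phi>) u = (\<Sum>i\<in>UNIV. \<Sum>j\<in>UNIV. inv_metric \<phi> u $ i $ j *
      (W (\<phi> u) \<bullet> pd i (pd j \<phi>) u + W' (pd i \<phi> u) \<bullet> pd j \<phi> u
       - (\<Sum>l\<in>UNIV. christoffel \<phi> u i j l * (W (\<phi> u) \<bullet> pd l \<phi> u))))"
    by (simp add: laplace_beltrami_coordinates[OF \<phi>] hessian grad[OF \<phi>(2)])
  moreover have "W (\<phi> u) \<bullet> mean_curvature_vec \<phi> u = (\<Sum>i\<in>UNIV. \<Sum>j\<in>UNIV. inv_metric \<phi> u $ i $ j *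
      (W (\<phi> u) \<bullet> pd i (pd j \<phi>) u - (\<Sum>l\<in>UNIV. christoffel \<phi> u i j l * (W (\<phi> u) \<bullet> pd l \<phi> u))))"
    by (simp add: mean_curvature_vec_christoffel inner_sum_right inner_diff_right)
  ultimately show ?thesis
    by (simp add: sum.distrib[symmetric] algebra_simps)
qed

section \<open>The test function\<close>

definition coord_proj :: "'m set \<Rightarrow> real^'m::finite \<Rightarrow> real^'m" where
  "coord_proj Z x = (\<chi> k. if k \<in> Z then x $ k else 0)"

lemma bounded_linear_coord_proj: "bounded_linear (coord_proj Z)"
  by (auto intro!: linearI simp: linear_conv_bounded_linear[symmetric] coord_proj_def vec_eq_iff)

lemma inner_coord_proj: "coord_proj Z x \<bullet> y = (\<Sum>k\<in>Z. x $ k * y $ k)"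
proof -
  have "coord_proj Z x \<bullet> y = (\<Sum>k\<in>UNIV. if k \<in> Z then x $ k * y $ k else 0)"
    unfolding inner_vec_def coord_proj_def by (rule sum.cong) auto
  also have "\<dots> = (\<Sum>k\<in>Z. x $ k * y $ k)"
    by (simp add: sum.If_cases)
  finally show ?thesis .
qed

definition ftest_grad :: "nat \<Rightarrow> 'm::finite \<Rightarrow> 'm \<Rightarrow> real \<Rightarrow> real^'m \<Rightarrow> real^'m" where
  "ftest_grad n a b s x =
     2 *\<^sub>R (x - pprime a b s) - (2 * (real n / (real n - 1))) *\<^sub>R coord_proj (UNIV - {a, b}) x"

lemma has_derivative_ftest: "(ftest n a b s has_derivative (\<lambda>y. ftest_grad n a b s x \<bullet> y)) (at x)"
proof -
  let ?p = "pprime a b s" and ?c = "real n / (real n - 1)" and ?Z = "UNIV - {a, b}"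
  have "ftest n a b s = (\<lambda>x. (x - ?p) \<bullet> (x - ?p) - ?c * (\<Sum>k\<in>?Z. x $ k * x $ k))"
    by (simp add: fun_eq_iff ftest_def dot_square_norm power2_eq_square)
  moreover have "((\<lambda>x. (x - ?p) \<bullet> (x - ?p) - ?c * (\<Sum>k\<in>?Z. x $ k * x $ k)) has_derivative
     (\<lambda>y. (x - ?p) \<bullet> y + y \<bullet> (x - ?p) - ?c * (\<Sum>k\<in>?Z. x $ k * y $ k + y $ k * x $ k))) (at x)"
    by (intro has_derivative_diff has_derivative_inner has_derivative_mult_right has_derivative_sum
        has_derivative_mult bounded_linear.has_derivative[OF bounded_linear_vec_nth] has_derivative_ident
        has_derivative_const) (auto intro!: derivative_eq_intros)
  moreover have "(\<lambda>y. (x - ?p) \<bullet> y + y \<bullet> (x - ?p) - ?c * (\<Sum>k\<in>?Z. x $ k * y $ k + y $ k * x $ k))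
      = (\<lambda>y. ftest_grad n a b s x \<bullet> y)"
  proof
    fix y
    have "(\<Sum>k\<in>?Z. x $ k * y $ k + y $ k * x $ k) = 2 * (\<Sum>k\<in>?Z. x $ k * y $ k)"
      by (simp add: sum.distrib mult.commute sum_distrib_left)
    moreover have "y \<bullet> (x - ?p) = (x - ?p) \<bullet> y"
      by (rule inner_commute)
    ultimately show "(x - ?p) \<bullet> y + y \<bullet> (x - ?p) - ?c * (\<Sum>k\<in>?Z. x $ k * y $ k + y $ k * x $ k)
        = ftest_grad n a b s x \<bullet> y"
      by (simp add: ftest_grad_def inner_diff_left inner_coord_proj)
  qed
  ultimately show ?thesis
    by simp
qed

lemma has_derivative_ftest_grad:
  "(ftest_grad n a b s has_derivative
     (\<lambda>y. 2 *\<^sub>R y - (2 * (real n / (real n - 1))) *\<^sub>R coord_proj (UNIV - {a, b}) y)) (at x)"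
proof -
  have "((\<lambda>x. 2 *\<^sub>R (x - pprime a b s) - (2 * (real n / (real n - 1))) *\<^sub>R coord_proj (UNIV - {a, b}) x)
      has_derivative (\<lambda>y. 2 *\<^sub>R (y - 0) - (2 * (real n / (real n - 1))) *\<^sub>R coord_proj (UNIV - {a, b}) y)) (at x)"
    by (intro has_derivative_diff has_derivative_scaleR_right has_derivative_ident has_derivative_const
        bounded_linear.has_derivative[OF bounded_linear_coord_proj])
  then show ?thesis
    by (simp add: ftest_grad_def[abs_def])
qed

lemma inv_gram_trace:
  fixes P :: "'k::finite \<Rightarrow> 'a::real_inner" and G :: "'k \<Rightarrow> 'k \<Rightarrow> real"
  assumes GP: "\<And>j l. (\<Sum>i\<in>UNIV. G j i * (P i \<bullet> P l)) = (if j = l then 1 else 0)"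
    and G: "\<And>i j. G i j = G j i"
  shows "(\<Sum>i\<in>UNIV. \<Sum>j\<in>UNIV. G i j * (P i \<bullet> P j)) = real CARD('k)"
proof -
  have "(\<Sum>i\<in>UNIV. \<Sum>j\<in>UNIV. G i j * (P i \<bullet> P j)) = (\<Sum>j\<in>UNIV. \<Sum>i\<in>UNIV. G j i * (P i \<bullet> P j))"
    by (subst sum.swap) (simp add: G)
  then show ?thesis
    by (simp add: GP)
qed

text \<open>The quadratic form is \<open>|\<pi>(e\<^sub>k)|\<^sup>2\<close> for the orthogonal projection \<open>\<pi>\<close> onto the span of
  the \<open>P i\<close>; it is at most \<open>1\<close> because \<open>|e\<^sub>k - \<pi>(e\<^sub>k)|\<^sup>2 = 1 - |\<pi>(e\<^sub>k)|\<^sup>2\<close>.\<close>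

lemma inv_gram_axis_le_1:
  fixes P :: "'k::finite \<Rightarrow> real^'m::finite" and G :: "'k \<Rightarrow> 'k \<Rightarrow> real"
  assumes GP: "\<And>j l. (\<Sum>i\<in>UNIV. G j i * (P i \<bullet> P l)) = (if j = l then 1 else 0)"
    and G: "\<And>i j. G i j = G j i"
  shows "(\<Sum>i\<in>UNIV. \<Sum>j\<in>UNIV. G i j * (P i $ k * P j $ k)) \<le> 1"
proof -
  define \<pi> where "\<pi> = (\<Sum>i\<in>UNIV. \<Sum>j\<in>UNIV. (G i j * P j $ k) *\<^sub>R P i)"
  have \<pi>_P: "\<pi> \<bullet> P l = P l $ k" for l
  proof -
    have "\<pi> \<bullet> P l = (\<Sum>j\<in>UNIV. \<Sum>i\<in>UNIV. G i j * P j $ k * (P i \<bullet> P l))"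
      unfolding \<pi>_def by (subst sum.swap) (simp add: inner_sum_left)
    also have "\<dots> = (\<Sum>j\<in>UNIV. P j $ k * (\<Sum>i\<in>UNIV. G j i * (P i \<bullet> P l)))"
      by (simp add: sum_distrib_left G mult_ac)
    also have "\<dots> = P l $ k"
      by (simp add: GP if_distrib cong: if_cong)
    finally show ?thesis .
  qed
  have \<pi>_k: "\<pi> $ k = (\<Sum>i\<in>UNIV. \<Sum>j\<in>UNIV. G i j * (P i $ k * P j $ k))"
    unfolding \<pi>_def by (simp add: sum_component mult_ac)
  have "\<pi> \<bullet> \<pi> = (\<Sum>i\<in>UNIV. \<Sum>j\<in>UNIV. G i j * P j $ k * (P i \<bullet> \<pi>))"
    by (subst (1) \<pi>_def) (simp add: inner_sum_left)
  moreover have "P i \<bullet> \<pi> = P i $ k" for i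
    using \<pi>_P[of i] by (simp add: inner_commute)
  ultimately have \<pi>_\<pi>: "\<pi> \<bullet> \<pi> = \<pi> $ k"
    unfolding \<pi>_k by (simp add: mult_ac)
  have "0 \<le> (axis k 1 - \<pi>) \<bullet> (axis k 1 - \<pi>)"
    by simp
  also have "\<dots> = 1 - \<pi> $ k"
    by (simp add: inner_diff_left inner_diff_right inner_commute[of "axis k 1" \<pi>] inner_axis_axis inner_axis \<pi>_\<pi>)
  finally show ?thesis
    unfolding \<pi>_k by simp
qed

lemma inv_gram_coord_proj_le:
  fixes P :: "'k::finite \<Rightarrow> real^'m::finite" and G :: "'k \<Rightarrow> 'k \<Rightarrow> real"
  assumes GP: "\<And>j l. (\<Sum>i\<in>UNIV. G j i * (P i \<bullet> P l)) = (if j = l then 1 else 0)"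
    and G: "\<And>i j. G i j = G j i"
  shows "(\<Sum>i\<in>UNIV. \<Sum>j\<in>UNIV. G i j * (coord_proj Z (P i) \<bullet> P j)) \<le> real (card Z)"
proof -
  have "(\<Sum>i\<in>UNIV. \<Sum>j\<in>UNIV. G i j * (coord_proj Z (P i) \<bullet> P j))
      = (\<Sum>k\<in>Z. \<Sum>i\<in>UNIV. \<Sum>j\<in>UNIV. G i j * (P i $ k * P j $ k))"
    by (simp add: inner_coord_proj sum_distrib_left sum.swap[of _ Z])
  also have "\<dots> \<le> (\<Sum>k\<in>Z. 1)"
    by (rule sum_mono) (rule inv_gram_axis_le_1[OF GP G])
  finally show ?thesis
    by simp
qed

lemma inv_gram_trace_hessian_ftest_nonneg:
  fixes P :: "'k::finite \<Rightarrow> real^'m::finite" and G :: "'k \<Rightarrow> 'k \<Rightarrow> real"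
  assumes GP: "\<And>j l. (\<Sum>i\<in>UNIV. G j i * (P i \<bullet> P l)) = (if j = l then 1 else 0)"
    and G: "\<And>i j. G i j = G j i"
    and card: "card Z + 1 = CARD('k)"
  shows "0 \<le> (\<Sum>i\<in>UNIV. \<Sum>j\<in>UNIV. G i j *
     ((2 *\<^sub>R P i - (2 * (real CARD('k) / (real CARD('k) - 1))) *\<^sub>R coord_proj Z (P i)) \<bullet> P j))"
proof -
  let ?n = "real CARD('k)"
  have "?n - 1 = real (card Z)"
    using card by (simp flip: card)
  then have "?n / (?n - 1) * (\<Sum>i\<in>UNIV. \<Sum>j\<in>UNIV. G i j * (coord_proj Z (P i) \<bullet> P j))
      \<le> ?n / (?n - 1) * real (card Z)"
    by (intro mult_left_mono inv_gram_coord_proj_le[OF GP G]) simp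
  also have "\<dots> \<le> ?n"
    using \<open>?n - 1 = real (card Z)\<close> by (cases "card Z = 0") simp_all
  finally have "?n / (?n - 1) * (\<Sum>i\<in>UNIV. \<Sum>j\<in>UNIV. G i j * (coord_proj Z (P i) \<bullet> P j)) \<le> ?n" .
  moreover have "(\<Sum>i\<in>UNIV. \<Sum>j\<in>UNIV. G i j *
     ((2 *\<^sub>R P i - (2 * (?n / (?n - 1))) *\<^sub>R coord_proj Z (P i)) \<bullet> P j))
     = 2 * (\<Sum>i\<in>UNIV. \<Sum>j\<in>UNIV. G i j * (P i \<bullet> P j))
       - 2 * (?n / (?n - 1)) * (\<Sum>i\<in>UNIV. \<Sum>j\<in>UNIV. G i j * (coord_proj Z (P i) \<bullet> P j))"
    by (simp add: inner_diff_left sum_subtractf sum_distrib_left algebra_simps)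
  ultimately show ?thesis
    using inv_gram_trace[OF GP G] by linarith
qed

lemma laplace_beltrami_ftest_nonneg:
  fixes \<phi> :: "real^'k::finite \<Rightarrow> real^'m::finite"
  assumes dim: "CARD('m) = CARD('k) + 1" and "a \<noteq> b"
    and minimal: "minimal_immersion_on U \<phi>" and "u \<in> U"
  shows "0 \<le> laplace_beltrami \<phi> (ftest CARD('k) a b s \<circ> \<phi>) u"
proof -
  have \<phi>: "immersion_on U \<phi>" and H: "mean_curvature_vec \<phi> u = 0"
    using minimal \<open>u \<in> U\<close> by (auto simp: minimal_immersion_on_def)
  have inv: "invertible (metric \<phi> u)"
    using immersion_on_metric_invertible[OF \<phi> \<open>u \<in> U\<close>] .
  have card: "card (UNIV - {a, b}) + 1 = CARD('k)"
    using dim \<open>a \<noteq> b\<close> by (simp add: card_Diff_subset)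
  have "laplace_beltrami \<phi> (ftest CARD('k) a b s \<circ> \<phi>) u = (\<Sum>i\<in>UNIV. \<Sum>j\<in>UNIV. inv_metric \<phi> u $ i $ j *
     ((2 *\<^sub>R pd i \<phi> u - (2 * (real CARD('k) / (real CARD('k) - 1))) *\<^sub>R coord_proj (UNIV - {a, b}) (pd i \<phi> u))
      \<bullet> pd j \<phi> u))"
    using laplace_beltrami_comp[OF \<phi> \<open>u \<in> U\<close> has_derivative_ftest has_derivative_ftest_grad] H by simp
  also have "0 \<le> \<dots>"
    by (rule inv_gram_trace_hessian_ftest_nonneg[OF inv_metric_metric[OF inv] inv_metric_commute[OF inv] card])
  finally show ?thesis .
qed

lemma ftest_eq_on_sphere:
  fixes x :: "real^'m::finite"
  assumes "a \<noteq> b" "norm x = s"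
  shows "ftest n a b s x = (3 - real n / (real n - 1)) * s\<^sup>2
      - x $ a * (2 * s - real n / (real n - 1) * x $ a) - x $ b * (2 * s - real n / (real n - 1) * x $ b)"
proof -
  have sum_split: "(\<Sum>k\<in>UNIV. f k) = (\<Sum>k\<in>UNIV - {a, b}. f k) + f a + f b" for f :: "'m \<Rightarrow> real"
    using sum.subset_diff[of "{a, b}" UNIV f] assms(1) by simp
  have norm_sq: "(norm y)\<^sup>2 = (\<Sum>k\<in>UNIV. (y $ k)\<^sup>2)" for y :: "real^'m"
    unfolding power2_norm_eq_inner inner_vec_def by (simp add: power2_eq_square)
  have "s\<^sup>2 = (\<Sum>k\<in>UNIV - {a, b}. (x $ k)\<^sup>2) + (x $ a)\<^sup>2 + (x $ b)\<^sup>2"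
    using norm_sq[of x] sum_split assms(2) by simp
  moreover have "(norm (x - pprime a b s))\<^sup>2 = (\<Sum>k\<in>UNIV - {a, b}. (x $ k)\<^sup>2) + (x $ a - s)\<^sup>2 + (x $ b - s)\<^sup>2"
    unfolding norm_sq sum_split using assms(1) by (simp add: pprime_def)
  ultimately show ?thesis
    unfolding ftest_def by (simp add: algebra_simps power2_eq_square)
qed

lemma ftest_le_on_sphere:
  fixes x :: "real^'m::finite"
  assumes "n \<ge> 2" "a \<noteq> b" "norm x = s" "0 \<le> x $ a" "0 \<le> x $ b"
  shows "ftest n a b s x \<le> (2 - 1 / (real n - 1)) * s\<^sup>2"
proof -
  let ?c = "real n / (real n - 1)"
  have c: "?c \<le> 2" "3 - ?c = 2 - 1 / (real n - 1)"
    using assms(1) by (auto simp: field_simps)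
  have "x $ a \<le> s" "x $ b \<le> s"
    using abs_le_D1[OF component_le_norm_cart[of x a]] abs_le_D1[OF component_le_norm_cart[of x b]] assms(3)
    by auto
  then have "?c * x $ a \<le> 2 * s" "?c * x $ b \<le> 2 * s"
    using mult_mono[OF c(1) \<open>x $ a \<le> s\<close>] mult_mono[OF c(1) \<open>x $ b \<le> s\<close>] assms(4,5) by simp_all
  then have "0 \<le> x $ a * (2 * s - ?c * x $ a)" "0 \<le> x $ b * (2 * s - ?c * x $ b)"
    using assms(4,5) by simp_all
  then show ?thesis
    unfolding ftest_eq_on_sphere[OF assms(2,3)] c(2) by linarith
qed

theorem lemma17:
  fixes \<phi> :: "'i \<Rightarrow> real^'k::finite \<Rightarrow> real^'m::finite"
    and U :: "'i \<Rightarrow> (real^'k) set"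
    and a b :: 'm and s :: real
  assumes dim: "CARD('m) = CARD('k) + 1" and n2: "CARD('k) \<ge> 2"
    and ab: "a \<noteq> b" and s: "s > 0"
    and minimal: "\<forall>i. minimal_immersion_on (U i) (\<phi> i)"
    and upper: "\<forall>i. \<forall>u\<in>U i. \<phi> i u $ b > 0"
  shows "(\<forall>i. \<forall>u\<in>U i. laplace_beltrami (\<phi> i) (ftest CARD('k) a b s \<circ> \<phi> i) u \<ge> 0)
       \<and> (ball 0 s \<inter> (\<Union>i. \<phi> i ` U i) \<subseteq> {x. x $ a > 0} \<longrightarrow>
           (\<forall>x\<in>closure (ball 0 s \<inter> (\<Union>i. \<phi> i ` U i)). norm x = s \<longrightarrow>
              ftest CARD('k) a b s x \<le> (2 - 1 / (real CARD('k) - 1)) * s\<^sup>2))"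
proof (intro conjI allI ballI impI)
  show "0 \<le> laplace_beltrami (\<phi> i) (ftest CARD('k) a b s \<circ> \<phi> i) u" if "u \<in> U i" for i u
    using laplace_beltrami_ftest_nonneg[OF dim ab] minimal that by blast
  fix x
  assume inside: "ball 0 s \<inter> (\<Union>i. \<phi> i ` U i) \<subseteq> {x. x $ a > 0}"
  have "0 \<le> y $ a \<and> 0 \<le> y $ b" if "y \<in> ball 0 s \<inter> (\<Union>i. \<phi> i ` U i)" for y
    using that subsetD[OF inside that] upper by (auto intro: less_imp_le)
  then have "ball 0 s \<inter> (\<Union>i. \<phi> i ` U i) \<subseteq> {x. 0 \<le> x $ a} \<inter> {x. 0 \<le> x $ b}"
    by blast
  then have "closure (ball 0 s \<inter> (\<Union>i. \<phi> i ` U i)) \<subseteq> {x. 0 \<le> x $ a} \<inter> {x. 0 \<le> x $ b}"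
    by (rule closure_minimal) (intro closed_Int closed_Collect_le continuous_intros)
  moreover assume "x \<in> closure (ball 0 s \<inter> (\<Union>i. \<phi> i ` U i))" "norm x = s"
  ultimately show "ftest CARD('k) a b s x \<le> (2 - 1 / (real CARD('k) - 1)) * s\<^sup>2"
    using ftest_le_on_sphere[OF n2 ab] by blast
qed

end
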